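(* Consider a thermal system in a Euclidean $*$-algebra $\mathbb{E}$ with Hermitian extensive variables $H$ and $X_j$ ($j\in J$). For reversible changes, we have the first law of thermodynamics $$d\overline H=T\,d\overline S+\alpha\cdot d\overline X$$ and the Gibbs-Duhem equation $$0=\overline S\,dT+\overline X\cdot d\alpha .$$
   Context: A Euclidean $*$-algebra $\mathbb{E}$ (finite- or infinite-dimensional) is an associative complex algebra (elements are called quantities) containing the complex numbers as constants, with an involution $*$ (conjugate-linear, $(gh)^*=h^*g^*$, $g^{**}=g$, reducing to complex conjugation on constants) and a complex-valued linear integral $\int$ defined on a subspace of strongly integrable quantities (possibly extended to a larger class of integrable quantities). One writes $g\ge0$ iff $g^*=g$ and $\int h^*gh\ge0$ for all strongly integrable $h$, and $g\ge h$ iff $g-h\ge0$; $g$ is Hermitian if $g^*=g$, and bounded if $g^*g\le a^2$ for some $a\in\mathbb{R}$. For bounded $g$ and strongly integrable $h,h_l$ one assumes: (EA1) $h^*,gh,hg$ are strongly integrable; (EA2) $(\int h)^*=\int h^*$, $\int gh=\int hg$; (EA3) $\int h^*h>0$ if $h\ne0$; (EA4) $\int h^*gh=0$ for all strongly integrable $h$ implies $g=0$; (EA5) $\int h_l^*h_l\to0$ implies $\int gh_l\to0$ and $\int h_l^*gh_l\to0$; (EA6) $h_l\downarrow0$ implies $\inf\int h_l=0$, where $h_l\downarrow0$ means that for every strongly integrable $h$ the numbers $\int h^*h_lh$ are real and decrease monotonically to $0$. Examples: $\mathbb{C}^{N\times N}$ with conjugate transpose and trace; algebras of functions on phase space with the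 Liouville integral; algebras of operators on a dense subspace of a Hilbert space with the trace. The usual calculus rules for functions of quantities are assumed to hold (they are automatic in finite dimension): $e^{af}e^{bf}=e^{(a+b)f}$ for real $a,b$; $(e^f)^*=e^{f^*}$; $e^fg=ge^f$ if $f,g$ commute; $\log e^f=f$ for Hermitian $f$; every $f\ge0$ has a square root $\sqrt f\ge0$ with $(\sqrt f)^2=f$; $\int$ may be interchanged with integration over a real parameter and with differentiation with respect to parameters; $\frac{d}{d\lambda}\int F(f)=\int F'(f)\frac{df}{d\lambda}$, and the analogous chain rule for functions of two commuting quantities. Let $k$ be the Boltzmann constant. A Gibbs state is a mapping $\langle g\rangle:=\int e^{-S/k}g$, where the entropy $S$ is a Hermitian quantity with strongly integrable $e^{-S/k}$ and $\int e^{-S/k}=1$. A thermal system is defined by a family of Hermitian quantities (the extensive variables) $H$ and $X_j$ ($j\in J$, $J$ finite), with $X=(X_j)_{j\in J}$ and $\alpha\cdot X=\sum_j\alpha_jX_j$. A thermal state is a Gibbs state whose entropy has the form $S=T^{-1}(H-\alpha\cdot X)$ with real $T\ne0$ and $\alpha\in\mathbb{R}^J$. The state space is the set of $(T,\alpha)$ with $T>0$ satisfying the equation of state $\Delta(T,\alpha)=0$, where $\Delta(T,\alpha)=\kappa T\log\int e^{-(H-\alpha\cdot X)/(kT)}$ with a fixed $\kappa>0$; each of its points defines a thermal state. Only regions where $\Delta$ is twice continuously differentiable are considered. Bars denote values in the thermal state at $(T,\alpha)$: $\overline H=\langle H\rangle$, $\overline S=\langle S\rangle$, $\overline X=(\langle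 X_j\rangle)_{j\in J}$. A reversible transformation (reversible change) is a continuously differentiable map $\lambda\mapsto(T(\lambda),\alpha(\lambda))$ from a real interval into the state space, and $d$ denotes the differential along such a map (divide by $d\lambda$ to get derivatives). *)

theory Defs
  imports "HOL-Analysis.Analysis"
begin

section \<open>Euclidean star-algebras\<close>

text \<open>
  The constants are the quantities \<open>cnst c\<close>.  The scalar multiple of a quantity \<open>g\<close> by a complex number \<open>c\<close> is \<open>cnst c * g\<close>.  The integral
  is a total function in HOL; its value is meaningful only on \<open>integrable_q\<close> quantities.
\<close>

class euclidean_star_ops = ring_1 +
  fixes cnst :: "complex \<Rightarrow> 'a"
    and adj :: "'a \<Rightarrow> 'a"
    and strongly_integrable :: "'a \<Rightarrow> bool"
    and integrable_q :: "'a \<Rightarrow> bool"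
    and integ :: "'a \<Rightarrow> complex"
    and qexp :: "'a \<Rightarrow> 'a"
    and qlog :: "'a \<Rightarrow> 'a"
begin

definition hermitian :: "'a \<Rightarrow> bool" where
  "hermitian g \<longleftrightarrow> adj g = g"

definition nonneg :: "'a \<Rightarrow> bool" where
  "nonneg g \<longleftrightarrow> hermitian g \<and>
     (\<forall>h. strongly_integrable h \<longrightarrow>
        integrable_q (adj h * g * h) \<and> integ (adj h * g * h) \<in> \<real> \<and> 0 \<le> Re (integ (adj h * g * h)))"

definition qle :: "'a \<Rightarrow> 'a \<Rightarrow> bool" where
  "qle h g \<longleftrightarrow> nonneg (g - h)"

definition bounded_q :: "'a \<Rightarrow> bool" where
  "bounded_q g \<longleftrightarrow> (\<exists>a::real. qle (adj g * g) (cnst (of_real (a\<^sup>2))))"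

definition decreases_to_0 :: "(nat \<Rightarrow> 'a) \<Rightarrow> bool" where
  "decreases_to_0 h \<longleftrightarrow> (\<forall>u. strongly_integrable u \<longrightarrow>
     (\<forall>l. integrable_q (adj u * h l * u) \<and> integ (adj u * h l * u) \<in> \<real>) \<and>
     decseq (\<lambda>l. Re (integ (adj u * h l * u))) \<and>
     (\<lambda>l. Re (integ (adj u * h l * u))) \<longlonglongrightarrow> 0)"

end

text \<open>
  The last axiom below is the chain rule \<open>d/d\<lambda> \<integral>F(f) = \<integral>F'(f) df/d\<lambda>\<close> for \<open>F = exp\<close>.  As an algebra of
  quantities carries no topology, the parameter-dependent Hermitian quantity is a combination
  \<open>f(\<lambda>) = c\<^sub>0(\<lambda>) g\<^sub>0 + \<dots> + c\<^sub>n\<^sub>-\<^sub>1(\<lambda>) g\<^sub>n\<^sub>-\<^sub>1\<close> of fixed Hermitian quantities with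
  differentiable real coefficients, whose derivative is the same combination of the derivatives of
  the coefficients.  The rule is demanded only where the exponential stays strongly integrable under
  all small changes of the coefficients: for integration of functions, it can fail at the boundary
  of the set of coefficients with integrable exponential.
\<close>

class euclidean_star_algebra = euclidean_star_ops +
  assumes cnst_add: "cnst (a + b) = cnst a + cnst b"
    and cnst_mult: "cnst (a * b) = cnst a * cnst b"
    and cnst_one: "cnst 1 = 1"
    and cnst_central: "cnst a * g = g * cnst a"
    and adj_add: "adj (g + h) = adj g + adj h"
    and adj_mult: "adj (g * h) = adj h * adj g"
    and adj_adj: "adj (adj g) = g"
    and adj_cnst: "adj (cnst a) = cnst (cnj a)"
    and strongly_integrable_zero: "strongly_integrable 0"
    and strongly_integrable_add:
      "strongly_integrable h \<Longrightarrow> strongly_integrable h' \<Longrightarrow> strongly_integrable (h + h')"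
    and strongly_integrable_scale:
      "strongly_integrable h \<Longrightarrow> strongly_integrable (cnst a * h)"
    and strongly_integrable_imp_integrable_q: "strongly_integrable h \<Longrightarrow> integrable_q h"
    and integrable_q_add: "integrable_q g \<Longrightarrow> integrable_q g' \<Longrightarrow> integrable_q (g + g')"
    and integrable_q_scale: "integrable_q g \<Longrightarrow> integrable_q (cnst a * g)"
    and integ_add: "integrable_q g \<Longrightarrow> integrable_q g' \<Longrightarrow> integ (g + g') = integ g + integ g'"
    and integ_scale: "integrable_q g \<Longrightarrow> integ (cnst a * g) = a * integ g"
    and integrable_q_adj_self: "strongly_integrable h \<Longrightarrow> integrable_q (adj h * h)"
    and EA1: "bounded_q g \<Longrightarrow> strongly_integrable h \<Longrightarrow>
      strongly_integrable (adj h) \<and> strongly_integrable (g * h) \<and> strongly_integrable (h * g)"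
    and EA2: "bounded_q g \<Longrightarrow> strongly_integrable h \<Longrightarrow>
      cnj (integ h) = integ (adj h) \<and> integ (g * h) = integ (h * g)"
    and EA3: "strongly_integrable h \<Longrightarrow> h \<noteq> 0 \<Longrightarrow>
      integ (adj h * h) \<in> \<real> \<and> 0 < Re (integ (adj h * h))"
    and EA4: "bounded_q g \<Longrightarrow> (\<And>h. strongly_integrable h \<Longrightarrow> integ (adj h * g * h) = 0) \<Longrightarrow> g = 0"
    and EA5: "bounded_q g \<Longrightarrow> (\<And>l::nat. strongly_integrable (hs l)) \<Longrightarrow>
      (\<lambda>l. integ (adj (hs l) * hs l)) \<longlonglongrightarrow> 0 \<Longrightarrow>
      (\<lambda>l. integ (g * hs l)) \<longlonglongrightarrow> 0 \<and> (\<lambda>l. integ (adj (hs l) * g * hs l)) \<longlonglongrightarrow> 0"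
    and EA6: "(\<And>l. strongly_integrable (hs l)) \<Longrightarrow> decreases_to_0 hs \<Longrightarrow>
      (\<forall>l. integ (hs l) \<in> \<real>) \<and> (INF l. ereal (Re (integ (hs l)))) = 0"
    and qexp_mult: "qexp (cnst (of_real s) * f) * qexp (cnst (of_real t) * f) =
      qexp (cnst (of_real (s + t)) * f)"
    and adj_qexp: "adj (qexp f) = qexp (adj f)"
    and qexp_commute: "f * g = g * f \<Longrightarrow> qexp f * g = g * qexp f"
    and qlog_qexp: "hermitian f \<Longrightarrow> qlog (qexp f) = f"
    and nonneg_sqrt: "nonneg f \<Longrightarrow> \<exists>r. nonneg r \<and> r\<^sup>2 = f"
    and integ_qexp_chain_rule:
      "\<lbrakk>\<And>i. i < (n::nat) \<Longrightarrow> hermitian (gs i);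
        \<And>i. i < n \<Longrightarrow> (c i has_real_derivative c' i) (at l);
        0 < \<epsilon>;
        \<And>d. (\<And>i. i < n \<Longrightarrow> \<bar>d i - c i l\<bar> < \<epsilon>) \<Longrightarrow>
          strongly_integrable (qexp (\<Sum>i<n. cnst (of_real (d i)) * gs i))\<rbrakk> \<Longrightarrow>
       integrable_q (qexp (\<Sum>i<n. cnst (of_real (c i l)) * gs i) *
         (\<Sum>i<n. cnst (of_real (c' i)) * gs i)) \<and>
       ((\<lambda>m. integ (qexp (\<Sum>i<n. cnst (of_real (c i m)) * gs i))) has_vector_derivative
         integ (qexp (\<Sum>i<n. cnst (of_real (c i l)) * gs i) *
           (\<Sum>i<n. cnst (of_real (c' i)) * gs i))) (at l)"


section \<open>Gibbs states and thermal systems\<close>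

definition gibbs_entropy :: "real \<Rightarrow> 'a::euclidean_star_ops \<Rightarrow> bool" where
  "gibbs_entropy k S \<longleftrightarrow> hermitian S \<and>
     strongly_integrable (qexp (cnst (of_real (- 1 / k)) * S)) \<and>
     integ (qexp (cnst (of_real (- 1 / k)) * S)) = 1"

definition gibbs_state :: "real \<Rightarrow> 'a::euclidean_star_ops \<Rightarrow> 'a \<Rightarrow> complex" where
  "gibbs_state k S g = integ (qexp (cnst (of_real (- 1 / k)) * S) * g)"

definition thermal_system :: "'a::euclidean_star_ops \<Rightarrow> ('j::finite \<Rightarrow> 'a) \<Rightarrow> bool" where
  "thermal_system H X \<longleftrightarrow> hermitian H \<and> (\<forall>j. hermitian (X j))"

definition qdot :: "real ^ 'j \<Rightarrow> ('j::finite \<Rightarrow> 'a::euclidean_star_ops) \<Rightarrow> 'a" where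
  "qdot \<alpha> X = (\<Sum>j\<in>UNIV. cnst (of_real (\<alpha> $ j)) * X j)"

definition entropy ::
  "'a::euclidean_star_ops \<Rightarrow> ('j::finite \<Rightarrow> 'a) \<Rightarrow> real \<Rightarrow> real ^ 'j \<Rightarrow> 'a" where
  "entropy H X T \<alpha> = cnst (of_real (1 / T)) * (H - qdot \<alpha> X)"

definition partition_integrand ::
  "real \<Rightarrow> 'a::euclidean_star_ops \<Rightarrow> ('j::finite \<Rightarrow> 'a) \<Rightarrow> real \<Rightarrow> real ^ 'j \<Rightarrow> 'a" where
  "partition_integrand k H X T \<alpha> = qexp (cnst (of_real (- 1 / (k * T))) * (H - qdot \<alpha> X))"

definition eos ::
  "real \<Rightarrow> real \<Rightarrow> 'a::euclidean_star_ops \<Rightarrow> ('j::finite \<Rightarrow> 'a) \<Rightarrow> real \<times> (real ^ 'j) \<Rightarrow> real" where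
  "eos k \<kappa> H X = (\<lambda>(T, \<alpha>). \<kappa> * T * ln (Re (integ (partition_integrand k H X T \<alpha>))))"

text \<open>
  The set where the formula for \<open>eos\<close> makes sense.  The integral is real there because
  its integrand is Hermitian; positivity is required for the logarithm (in HOL, \<open>ln 0 = 0\<close>).
\<close>

definition eos_domain ::
  "real \<Rightarrow> 'a::euclidean_star_ops \<Rightarrow> ('j::finite \<Rightarrow> 'a) \<Rightarrow> (real \<times> (real ^ 'j)) set" where
  "eos_domain k H X = {(T, \<alpha>). T \<noteq> 0 \<and> strongly_integrable (partition_integrand k H X T \<alpha>) \<and>
     0 < Re (integ (partition_integrand k H X T \<alpha>))}"

definition state_space ::
  "real \<Rightarrow> real \<Rightarrow> 'a::euclidean_star_ops \<Rightarrow> ('j::finite \<Rightarrow> 'a) \<Rightarrow> (real \<times> (real ^ 'j)) set" where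
  "state_space k \<kappa> H X = {(T, \<alpha>). 0 < T \<and> (T, \<alpha>) \<in> eos_domain k H X \<and> eos k \<kappa> H X (T, \<alpha>) = 0}"

definition twice_continuously_differentiable_on ::
  "('x::real_normed_vector \<Rightarrow> real) \<Rightarrow> 'x set \<Rightarrow> bool" where
  "twice_continuously_differentiable_on f U \<longleftrightarrow>
     (\<exists>(f' :: 'x \<Rightarrow> 'x \<Rightarrow>\<^sub>L real) (f'' :: 'x \<Rightarrow> 'x \<Rightarrow>\<^sub>L 'x \<Rightarrow>\<^sub>L real).
        (\<forall>x\<in>U. (f has_derivative blinfun_apply (f' x)) (at x) \<and>
               (f' has_derivative blinfun_apply (f'' x)) (at x)) \<and>
        continuous_on U f'')"

definition regular_region ::
  "real \<Rightarrow> real \<Rightarrow> 'a::euclidean_star_ops \<Rightarrow> ('j::finite \<Rightarrow> 'a) \<Rightarrow> (real \<times> (real ^ 'j)) set \<Rightarrow> bool"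
where
  "regular_region k \<kappa> H X U \<longleftrightarrow> open U \<and> U \<subseteq> eos_domain k H X \<and>
     twice_continuously_differentiable_on (eos k \<kappa> H X) U"

text \<open>
  The interval may contain its end points, where derivatives are one-sided; it is not a single
  point, so that derivatives within it are unique.
\<close>

definition reversible_transformation ::
  "real \<Rightarrow> real \<Rightarrow> 'a::euclidean_star_ops \<Rightarrow> ('j::finite \<Rightarrow> 'a) \<Rightarrow>
   real set \<Rightarrow> (real \<Rightarrow> real) \<Rightarrow> (real \<Rightarrow> real ^ 'j) \<Rightarrow> bool" where
  "reversible_transformation k \<kappa> H X L T \<alpha> \<longleftrightarrow>
     is_interval L \<and> (\<exists>a\<in>L. \<exists>b\<in>L. a < b) \<and>
     (\<exists>T' \<alpha>'. (\<forall>l\<in>L. (T has_real_derivative T' l) (at l within L) \<and>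
                     (\<alpha> has_vector_derivative \<alpha>' l) (at l within L)) \<and>
              continuous_on L T' \<and> continuous_on L \<alpha>') \<and>
     (\<forall>l\<in>L. (T l, \<alpha> l) \<in> state_space k \<kappa> H X)"

definition thermal_mean ::
  "real \<Rightarrow> 'a::euclidean_star_ops \<Rightarrow> ('j::finite \<Rightarrow> 'a) \<Rightarrow> real \<Rightarrow> real ^ 'j \<Rightarrow> 'a \<Rightarrow> complex" where
  "thermal_mean k H X T \<alpha> g = gibbs_state k (entropy H X T \<alpha>) g"

definition mean_H ::
  "real \<Rightarrow> 'a::euclidean_star_ops \<Rightarrow> ('j::finite \<Rightarrow> 'a) \<Rightarrow> real \<Rightarrow> real ^ 'j \<Rightarrow> complex" where
  "mean_H k H X T \<alpha> = thermal_mean k H X T \<alpha> H"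

definition mean_S ::
  "real \<Rightarrow> 'a::euclidean_star_ops \<Rightarrow> ('j::finite \<Rightarrow> 'a) \<Rightarrow> real \<Rightarrow> real ^ 'j \<Rightarrow> complex" where
  "mean_S k H X T \<alpha> = thermal_mean k H X T \<alpha> (entropy H X T \<alpha>)"

definition mean_X ::
  "real \<Rightarrow> 'a::euclidean_star_ops \<Rightarrow> ('j::finite \<Rightarrow> 'a) \<Rightarrow> real \<Rightarrow> real ^ 'j \<Rightarrow> complex ^ 'j" where
  "mean_X k H X T \<alpha> = (\<chi> j. thermal_mean k H X T \<alpha> (X j))"

lemma bounded_q_one: "bounded_q (1::'a::euclidean_star_algebra)"
proof -
  have z: "cnst 0 = (0::'a)"
    using cnst_add[of 0 0] by simp
  have i0: "integ (0::'a) = 0" "integrable_q (0::'a)"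
    using integ_scale[of "0::'a" 0] strongly_integrable_zero strongly_integrable_imp_integrable_q
    by (auto simp: z)
  have a0: "adj 0 = (0::'a)" using adj_add[of "0::'a" 0] by simp
  have a1: "adj 1 = (1::'a)" using adj_cnst[of 1] by (simp add: cnst_one)
  have "nonneg (0::'a)" unfolding nonneg_def hermitian_def by (simp add: i0 a0)
  then have "qle (adj 1 * 1) (cnst (of_real (1\<^sup>2)) :: 'a)"
    by (simp add: qle_def a1 cnst_one)
  then show ?thesis unfolding bounded_q_def by blast
qed

text \<open>Every point of the state space defines a thermal state.\<close>

lemma gibbs_entropy_entropy:
  fixes H :: "'a::euclidean_star_algebra"
  assumes "thermal_system H X" "0 < \<kappa>" "(T, \<alpha>) \<in> state_space k \<kappa> H X"
  shows "gibbs_entropy k (entropy H X T \<alpha>)"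
proof -
  have z: "cnst 0 = (0::'a)" using cnst_add[of 0 0] by simp
  have a0: "adj 0 = (0::'a)" using adj_add[of "0::'a" 0] by simp
  have am: "adj (- g) = - adj g" for g :: 'a
    using adj_add[of g "- g"] a0 by (simp add: eq_neg_iff_add_eq_0 add.commute)
  have asum: "finite A \<Longrightarrow> adj (sum f A) = (\<Sum>i\<in>A. adj (f i))" for A :: "'b set" and f :: "'b \<Rightarrow> 'a"
    by (induction A rule: finite_induct) (auto simp: a0 adj_add)
  have asc: "adj (cnst (of_real r) * g) = cnst (of_real r) * adj g" for r and g :: 'a
    by (simp add: adj_mult adj_cnst cnst_central)
  let ?S = "entropy H X T \<alpha>"
  have S: "hermitian ?S"
    using assms(1) unfolding hermitian_def entropy_def qdot_def thermal_system_def
    by (simp only: asc diff_conv_add_uminus adj_add am) (simp add: asum asc)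
  have e: "qexp (cnst (of_real (- 1 / k)) * ?S) = partition_integrand k H X T \<alpha>"
    unfolding entropy_def partition_integrand_def mult.assoc[symmetric] cnst_mult[symmetric]
    by simp
  let ?Z = "integ (partition_integrand k H X T \<alpha>)"
  have st: "0 < T" "strongly_integrable (partition_integrand k H X T \<alpha>)" "0 < Re ?Z" "ln (Re ?Z) = 0"
    using assms(2,3) by (auto simp: state_space_def eos_domain_def eos_def)
  have "adj (partition_integrand k H X T \<alpha>) = partition_integrand k H X T \<alpha>"
    using S unfolding e[symmetric] by (simp only: adj_qexp asc hermitian_def)
  then have "cnj ?Z = ?Z"
    using EA2[OF bounded_q_one st(2)] by simp
  moreover have "Re ?Z = 1" using st(3,4) by simp
  ultimately have "?Z = 1" by (simp add: complex_eq_iff)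
  with S st(2) show ?thesis unfolding gibbs_entropy_def e by simp
qed

end

theory Submission
  imports Defs
begin

text \<open>
  Where \<open>\<Delta> = 0\<close>, the partition function equals \<open>1\<close>, and the chain rule for the integral gives
  \<open>\<partial>\<Delta>/\<partial>T = (\<kappa>/k) \<langle>S\<rangle>\<close> and \<open>\<partial>\<Delta>/\<partial>\<alpha>\<^sub>j = (\<kappa>/k) \<langle>X\<^sub>j\<rangle>\<close>. The Gibbs-Duhem equation is therefore \<open>d\<Delta> = 0\<close>
  along the transformation. As \<open>\<Delta>\<close> is twice differentiable, \<open>\<langle>S\<rangle>\<close> and \<open>\<langle>X\<rangle>\<close> are differentiable along it,
  and differentiating the Euler equation \<open>\<langle>H\<rangle> = T \<langle>S\<rangle> + \<alpha> \<cdot> \<langle>X\<rangle>\<close> and subtracting the Gibbs-Duhem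
  equation gives the first law.
\<close>

section \<open>Algebra of constants, adjoints and linear combinations of quantities\<close>

lemma cnst_zero: "cnst 0 = (0::'a::euclidean_star_algebra)"
  using cnst_add[of 0 0] by simp

lemma cnst_minus: "cnst (- a) = - (cnst a :: 'a::euclidean_star_algebra)"
  using cnst_add[of a "- a"] by (simp add: cnst_zero eq_neg_iff_add_eq_0 add.commute)

lemma cnst_diff: "cnst (a - b) = cnst a - (cnst b :: 'a::euclidean_star_algebra)"
  using cnst_add[of a "- b"] by (simp add: cnst_minus)

lemma cnst_mult_assoc: "cnst a * (cnst b * g) = cnst (a * b) * (g :: 'a::euclidean_star_algebra)"
  by (simp add: cnst_mult mult.assoc)

lemma mult_cnst_left_commute:
  "g * (cnst a * h) = cnst a * (g * (h :: 'a::euclidean_star_algebra))"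
  by (metis cnst_central mult.assoc)

lemma adj_zero: "adj 0 = (0::'a::euclidean_star_algebra)"
  using adj_add[of "0::'a" 0] by simp

lemma hermitian_scale:
  "hermitian g \<Longrightarrow> hermitian (cnst (of_real r) * (g :: 'a::euclidean_star_algebra))"
  by (simp add: hermitian_def adj_mult adj_cnst cnst_central)

lemma hermitian_sum:
  fixes g :: "'i \<Rightarrow> 'a::euclidean_star_algebra"
  shows "(\<And>i. i \<in> A \<Longrightarrow> hermitian (g i)) \<Longrightarrow> hermitian (sum g A)"
  by (induction A rule: infinite_finite_induct)
    (simp_all add: hermitian_def adj_zero adj_add)

lemma hermitian_qdot:
  fixes X :: "'j::finite \<Rightarrow> 'a::euclidean_star_algebra"
  shows "(\<And>j. hermitian (X j)) \<Longrightarrow> hermitian (qdot \<alpha> X)"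
  unfolding qdot_def by (intro hermitian_sum hermitian_scale)

lemma cnst_scale_qdot:
  fixes X :: "'j::finite \<Rightarrow> 'a::euclidean_star_algebra"
  shows "cnst (of_real r) * qdot \<alpha> X = qdot (r *\<^sub>R \<alpha>) X"
  by (simp add: qdot_def sum_distrib_left cnst_mult_assoc)

lemma qdot_zero:
  fixes X :: "'j::finite \<Rightarrow> 'a::euclidean_star_algebra"
  shows "qdot 0 X = 0"
  by (simp add: qdot_def cnst_zero)

lemma qdot_axis:
  fixes X :: "'j::finite \<Rightarrow> 'a::euclidean_star_algebra"
  shows "qdot (axis j 1) X = X j"
proof -
  have "qdot (axis j 1) X = (\<Sum>i\<in>UNIV. if i = j then X j else 0)"
    unfolding qdot_def by (intro sum.cong) (auto simp: axis_def cnst_zero cnst_one)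
  then show ?thesis by simp
qed

section \<open>Integrals of exponentials and the chain rule for coefficient vectors\<close>

text \<open>The exponential of a Hermitian quantity is Hermitian, so \<open>EA2\<close>, applied
  with the bounded quantity \<open>1\<close>, equates its integral with the conjugate of that
  integral.\<close>

lemma Im_integ_qexp:
  fixes f :: "'a::euclidean_star_algebra"
  assumes "hermitian f" and "strongly_integrable (qexp f)"
  shows "Im (integ (qexp f)) = 0"
proof -
  have "cnj (integ (qexp f)) = integ (qexp f)"
    using EA2[OF bounded_q_one assms(2)] assms(1) by (simp add: adj_qexp hermitian_def)
  then show ?thesis by (simp add: complex_eq_iff)
qed

lemma integrable_q_sum:
  fixes g :: "'i \<Rightarrow> 'a::euclidean_star_algebra"
  assumes "\<And>i. i \<in> A \<Longrightarrow> integrable_q (g i)"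
  shows "integrable_q (sum g A)" and "integ (sum g A) = (\<Sum>i\<in>A. integ (g i))"
proof -
  \<comment> \<open>The value at \<open>0\<close> covers both the empty sum and the sum over an
    infinite index set, which is \<open>0\<close> by convention.\<close>
  have zero: "integrable_q (0::'a)" "integ (0::'a) = 0"
    using integ_scale[of "0::'a" 0] strongly_integrable_zero strongly_integrable_imp_integrable_q
    by (auto simp: cnst_zero)
  have "integrable_q (sum g A) \<and> integ (sum g A) = (\<Sum>i\<in>A. integ (g i))"
    using assms
    by (induction A rule: infinite_finite_induct) (auto simp: zero integrable_q_add integ_add)
  then show "integrable_q (sum g A)" and "integ (sum g A) = (\<Sum>i\<in>A. integ (g i))" by auto
qed

text \<open>The class axiom speaks of quantities numbered from \<open>0\<close> to
  \<open>n - 1\<close> and of a box of coefficients. An enumeration \<open>e\<close> of the index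
  type carries it over to coefficient vectors, with an open set \<open>V\<close> in place of the
  box.\<close>

lemma integ_qexp_qdot_chain_rule:
  fixes g :: "'i::finite \<Rightarrow> 'a::euclidean_star_algebra"
  assumes herm: "\<And>i. hermitian (g i)"
    and c: "(c has_vector_derivative c') (at l)"
    and V: "open V" "c l \<in> V" "\<And>d. d \<in> V \<Longrightarrow> strongly_integrable (qexp (qdot d g))"
  shows "integrable_q (qexp (qdot (c l) g) * qdot c' g)" (is ?int)
    and "((\<lambda>m. integ (qexp (qdot (c m) g))) has_vector_derivative
      integ (qexp (qdot (c l) g) * qdot c' g)) (at l)" (is ?der)
proof -
  define n where "n = CARD('i)"
  have "n > 0" by (simp add: n_def)
  obtain e where e: "bij_betw e {..<n} (UNIV :: 'i set)"
    using ex_bij_betw_nat_finite[of "UNIV :: 'i set"] by (auto simp: n_def atLeast0LessThan)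
  have qdot_e: "(\<Sum>i<n. cnst (of_real (d $ e i)) * g (e i)) = qdot d g" for d
    unfolding qdot_def by (rule sum.reindex_bij_betw[OF e])
  obtain \<delta> where \<delta>: "\<delta> > 0" "ball (c l) \<delta> \<subseteq> V" using V(1,2) openE by blast
  \<comment> \<open>The axiom bounds each coordinate separately. With \<open>n\<close> deviations
    below \<open>\<delta> / n\<close>, the l1 norm stays below \<open>\<delta>\<close>, and it
    dominates the Euclidean norm that defines the ball inside \<open>V\<close>.\<close>
  have V': "strongly_integrable (qexp (\<Sum>i<n. cnst (of_real (d i)) * g (e i)))"
    if d: "\<And>i. i < n \<Longrightarrow> \<bar>d i - c l $ e i\<bar> < \<delta> / n" for d
  proof -
    define d' :: "real^'i" where "d' = (\<chi> i. d (inv_into {..<n} e i))"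
    have de: "d' $ e i = d i" if "i < n" for i
      using that e by (simp add: d'_def bij_betw_inv_into_left)
    have "norm (d' - c l) \<le> (\<Sum>i\<in>UNIV. \<bar>(d' - c l) $ i\<bar>)" by (rule norm_le_l1_cart)
    also have "\<dots> = (\<Sum>i<n. \<bar>(d' - c l) $ e i\<bar>)"
      by (rule sum.reindex_bij_betw[OF e, symmetric])
    also have "\<dots> < (\<Sum>i<n. \<delta> / n)"
      using d \<open>n > 0\<close> by (intro sum_strict_mono) (auto simp: de)
    also have "\<dots> = \<delta>" using \<open>n > 0\<close> by simp
    finally have "d' \<in> V" using \<delta>(2) by (auto simp: dist_norm norm_minus_commute)
    from V(3)[OF this] show ?thesis by (simp add: de flip: qdot_e)
  qed
  have c_e: "((\<lambda>m. c m $ e i) has_real_derivative c' $ e i) (at l)" for i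
    using bounded_linear.has_vector_derivative[OF bounded_linear_vec_nth c]
    by (simp add: has_real_derivative_iff_has_vector_derivative)
  have "0 < \<delta> / n" using \<delta> \<open>n > 0\<close> by simp
  from integ_qexp_chain_rule[of n "\<lambda>i. g (e i)" "\<lambda>i m. c m $ e i" "\<lambda>i. c' $ e i" l,
      OF herm c_e this V']
  show ?int ?der by (simp_all add: qdot_e)
qed

section \<open>Temperature and \<alpha> as coordinates for Boltzmann coefficients\<close>

text \<open>The entries lie in a Euclidean space so that the rule serves the real coefficient
  vectors as well as the complex vector of means.\<close>

lemma has_vector_derivative_vecI:
  fixes f :: "real \<Rightarrow> 'b::euclidean_space ^ 'i::finite"
  assumes "\<And>i. ((\<lambda>m. f m $ i) has_vector_derivative f' $ i) (at l within S)"
  shows "(f has_vector_derivative f') (at l within S)"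
  unfolding has_vector_derivative_def
proof (subst has_derivative_componentwise_within, rule ballI)
  fix b :: "'b ^ 'i" assume "b \<in> Basis"
  then obtain i u where b: "b = axis i u" by (auto simp: Basis_vec_def)
  have "((\<lambda>m. f m $ i \<bullet> u) has_derivative (\<lambda>x. (x *\<^sub>R f' $ i) \<bullet> u)) (at l within S)"
    using assms[of i] unfolding has_vector_derivative_def by (rule has_derivative_inner_left)
  then show "((\<lambda>m. f m \<bullet> b) has_derivative (\<lambda>x. (x *\<^sub>R f') \<bullet> b)) (at l within S)"
    by (simp add: b inner_axis)
qed

text \<open>The coefficients of \<open>-(H - \<alpha> \<cdot> X) / (k T)\<close>, with \<open>None\<close> as the index of \<open>H\<close>.\<close>

definition boltzmann_coeffs :: "real \<Rightarrow> real \<Rightarrow> real ^ 'j \<Rightarrow> real ^ ('j::finite option)" where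
  "boltzmann_coeffs k T \<alpha> = (\<chi> i. case i of None \<Rightarrow> - 1 / (k * T) | Some j \<Rightarrow> \<alpha> $ j / (k * T))"

text \<open>Treating \<open>H\<close> as one more variable, at the index \<open>None\<close>, lets a
  single linear combination carry the whole exponent, as the chain rule requires.\<close>

lemma qdot_option:
  fixes X :: "'j::finite \<Rightarrow> 'a::euclidean_star_algebra"
  shows "qdot d (case_option H X) =
    cnst (of_real (d $ None)) * H + qdot (\<chi> j. d $ Some j) X"
  unfolding qdot_def by (simp add: UNIV_option_conv sum.reindex)

lemma partition_integrand_eq_qexp_qdot:
  fixes H :: "'a::euclidean_star_algebra"
  shows "partition_integrand k H X T \<alpha> = qexp (qdot (boltzmann_coeffs k T \<alpha>) (case_option H X))"
proof -
  have *: "(\<chi> j. \<alpha> $ j / (k * T)) = (1 / (k * T)) *\<^sub>R \<alpha>"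
    by (simp add: vec_eq_iff)
  show ?thesis
    unfolding partition_integrand_def qdot_option
    by (simp add: boltzmann_coeffs_def * right_diff_distrib cnst_minus flip: cnst_scale_qdot)
qed

lemma has_vector_derivative_boltzmann_coeffs:
  assumes "k \<noteq> 0" "T l \<noteq> 0"
    and T: "(T has_real_derivative T') (at l)"
    and \<alpha>: "(\<alpha> has_vector_derivative \<alpha>') (at l)"
  shows "((\<lambda>m. boltzmann_coeffs k (T m) (\<alpha> m)) has_vector_derivative
    (\<chi> i. case i of None \<Rightarrow> T' / (k * (T l)\<^sup>2)
      | Some j \<Rightarrow> \<alpha>' $ j / (k * T l) - \<alpha> l $ j * T' / (k * (T l)\<^sup>2))) (at l)"
    (is "(_ has_vector_derivative ?D) _")
proof -
  have \<alpha>j: "((\<lambda>m. \<alpha> m $ j) has_real_derivative \<alpha>' $ j) (at l)" for j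
    using bounded_linear.has_vector_derivative[OF bounded_linear_vec_nth \<alpha>]
    by (simp add: has_real_derivative_iff_has_vector_derivative)
  have "((\<lambda>m. boltzmann_coeffs k (T m) (\<alpha> m) $ i) has_real_derivative ?D $ i) (at l)" for i
    using assms(1,2)
    by (cases i)
      (auto simp: boltzmann_coeffs_def power2_eq_square field_simps
        intro!: derivative_eq_intros T \<alpha>j)
  then show ?thesis
    by (intro has_vector_derivative_vecI) (simp add: has_real_derivative_iff_has_vector_derivative)
qed

lemma qdot_diff:
  fixes X :: "'j::finite \<Rightarrow> 'a::euclidean_star_algebra"
  shows "qdot (\<alpha> - \<beta>) X = qdot \<alpha> X - qdot \<beta> X"
  by (simp add: qdot_def cnst_diff left_diff_distrib sum_subtractf)

text \<open>Solving for temperature and \<alpha> gives \<open>T = - 1 / (k * d $ None)\<close> and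
  \<open>\<alpha> $ j = - d $ Some j / d $ None\<close>. This inverse is continuous where
  \<open>d $ None\<close> is nonzero, so the open region \<open>U\<close> pulls back to an open set
  of coefficients, which the stability condition of the chain rule calls for.\<close>

lemma open_boltzmann_coeffs_region:
  fixes U :: "(real \<times> (real ^ 'j::finite)) set"
  assumes "open U" and "k \<noteq> 0"
  defines "V \<equiv> {d :: real ^ ('j option). d $ None \<noteq> 0 \<and>
    (- 1 / (k * d $ None), \<chi> j. - (d $ Some j) / d $ None) \<in> U}"
  shows "open V"
    and "T \<noteq> 0 \<Longrightarrow> boltzmann_coeffs k T \<alpha> \<in> V \<longleftrightarrow> (T, \<alpha>) \<in> U"
    and "d \<in> V \<Longrightarrow> \<exists>T \<alpha>. (T, \<alpha>) \<in> U \<and> d = boltzmann_coeffs k T \<alpha>"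
proof -
  let ?W = "{d :: real ^ ('j option). d $ None \<noteq> 0}"
  let ?f = "\<lambda>d :: real ^ ('j option). (- 1 / (k * d $ None), \<chi> j. - (d $ Some j) / d $ None)"
  have "open ?W" by (intro open_Collect_neq continuous_intros)
  moreover have "continuous_on ?W ?f"
    using \<open>k \<noteq> 0\<close> by (intro continuous_intros continuous_on_vec_lambda) auto
  ultimately have "open (?W \<inter> ?f -` U)"
    using \<open>open U\<close> by (intro continuous_open_preimage)
  moreover have "?W \<inter> ?f -` U = V" by (auto simp: V_def)
  ultimately show "open V" by simp
  show "boltzmann_coeffs k T \<alpha> \<in> V \<longleftrightarrow> (T, \<alpha>) \<in> U" if "T \<noteq> 0"
    using that \<open>k \<noteq> 0\<close> by (simp add: V_def boltzmann_coeffs_def)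
  show "\<exists>T \<alpha>. (T, \<alpha>) \<in> U \<and> d = boltzmann_coeffs k T \<alpha>" if "d \<in> V"
  proof (intro exI conjI)
    show "?f d \<in> U" using that by (simp add: V_def)
    show "d = boltzmann_coeffs k (- 1 / (k * d $ None)) (\<chi> j. - (d $ Some j) / d $ None)"
      using that \<open>k \<noteq> 0\<close>
      by (auto simp: V_def boltzmann_coeffs_def vec_eq_iff split: option.split)
  qed
qed

text \<open>\<open>Q\<close> is the derivative of the exponent
  \<open>-(H - \<alpha> \<cdot> X) / (k T)\<close> along the curve, with the terms containing
  \<open>T'\<close> collected in front of \<open>H - \<alpha> \<cdot> X\<close>.\<close>

lemma partition_function_chain_rule:
  fixes H :: "'a::euclidean_star_algebra" and X :: "'j::finite \<Rightarrow> 'a"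
  assumes "k \<noteq> 0" and sys: "thermal_system H X"
    and U: "open U" "U \<subseteq> eos_domain k H X" "(T l, \<alpha> l) \<in> U"
    and T: "(T has_real_derivative T') (at l)"
    and \<alpha>: "(\<alpha> has_vector_derivative \<alpha>') (at l)"
  defines "Q \<equiv> cnst (of_real (T' / (k * (T l)\<^sup>2))) * (H - qdot (\<alpha> l) X) +
      cnst (of_real (1 / (k * T l))) * qdot \<alpha>' X"
  shows "integrable_q (partition_integrand k H X (T l) (\<alpha> l) * Q)" (is ?int)
    and "((\<lambda>m. integ (partition_integrand k H X (T m) (\<alpha> m))) has_vector_derivative
      integ (partition_integrand k H X (T l) (\<alpha> l) * Q)) (at l)" (is ?der)
proof -
  let ?g = "case_option H X"
  define D :: "real ^ ('j option)" where
    "D = (\<chi> i. case i of None \<Rightarrow> T' / (k * (T l)\<^sup>2)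
      | Some j \<Rightarrow> \<alpha>' $ j / (k * T l) - \<alpha> l $ j * T' / (k * (T l)\<^sup>2))"
  have T0: "T l \<noteq> 0" using U(2,3) by (auto simp: eos_domain_def)
  have "(\<chi> j. D $ Some j) = (1 / (k * T l)) *\<^sub>R \<alpha>' - (T' / (k * (T l)\<^sup>2)) *\<^sub>R \<alpha> l"
    by (simp add: vec_eq_iff D_def)
  moreover have "D $ None = T' / (k * (T l)\<^sup>2)" by (simp add: D_def)
  ultimately have Q: "qdot D ?g = Q"
    unfolding qdot_option Q_def
    by (simp add: qdot_diff right_diff_distrib flip: cnst_scale_qdot)
  note V = open_boltzmann_coeffs_region[OF U(1) \<open>k \<noteq> 0\<close>]
  have herm: "hermitian (?g i)" for i
    using sys by (cases i) (auto simp: thermal_system_def)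
  have "((\<lambda>m. boltzmann_coeffs k (T m) (\<alpha> m)) has_vector_derivative D) (at l)"
    unfolding D_def using \<open>k \<noteq> 0\<close> T0 T \<alpha> by (rule has_vector_derivative_boltzmann_coeffs)
  \<comment> \<open>Every coefficient vector in the open set arises from a point of
    \<open>U\<close>, so integrability on \<open>U\<close> provides integrability under all small
    changes of the coefficients.\<close>
  moreover have "strongly_integrable (qexp (qdot (boltzmann_coeffs k T \<alpha>) ?g))"
    if "(T, \<alpha>) \<in> U" for T \<alpha>
    using that U(2) by (auto simp: eos_domain_def partition_integrand_eq_qexp_qdot)
  ultimately show ?int ?der
    unfolding partition_integrand_eq_qexp_qdot Q[symmetric]
    using integ_qexp_qdot_chain_rule[of ?g "\<lambda>m. boltzmann_coeffs k (T m) (\<alpha> m)" D l,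
        OF herm _ V(1)] V(2)[OF T0] U(3) V(3) by blast+
qed

section \<open>The equation of state and its first derivatives\<close>

lemma Im_partition_function:
  fixes H :: "'a::euclidean_star_algebra"
  assumes "thermal_system H X" and "(T, \<alpha>) \<in> eos_domain k H X"
  shows "Im (integ (partition_integrand k H X T \<alpha>)) = 0"
proof -
  have "hermitian (case_option H X i)" for i
    using assms(1) by (cases i) (auto simp: thermal_system_def)
  then show ?thesis
    using assms(2) unfolding partition_integrand_eq_qexp_qdot
    by (intro Im_integ_qexp hermitian_qdot)
      (auto simp: eos_domain_def partition_integrand_eq_qexp_qdot)
qed

lemma thermal_mean_eq:
  fixes H :: "'a::euclidean_star_algebra"
  shows "thermal_mean k H X T \<alpha> g = integ (partition_integrand k H X T \<alpha> * g)"
  by (simp add: thermal_mean_def gibbs_state_def entropy_def partition_integrand_def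
      cnst_mult_assoc flip: of_real_mult)

text \<open>\<Delta> is differentiated along the straight line through the state in direction
  \<open>(\<tau>, a)\<close> in two ways: through \<open>D\<close>, and through the logarithm of the
  partition function. Uniqueness of the derivative equates the results.\<close>

lemma eos_derivative:
  fixes H :: "'a::euclidean_star_algebra" and X :: "'j::finite \<Rightarrow> 'a"
  assumes "k \<noteq> 0" and sys: "thermal_system H X"
    and U: "open U" "U \<subseteq> eos_domain k H X" "(T, \<alpha>) \<in> U"
    and state: "integ (partition_integrand k H X T \<alpha>) = 1"
    and D: "(eos k \<kappa> H X has_derivative D) (at (T, \<alpha>))"
  defines "Q \<equiv> \<lambda>\<tau> a. cnst (of_real (\<tau> / (k * T\<^sup>2))) * (H - qdot \<alpha> X) +
      cnst (of_real (1 / (k * T))) * qdot a X"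
  shows "integrable_q (partition_integrand k H X T \<alpha> * Q \<tau> a)"
    and "of_real (\<kappa> * T) * integ (partition_integrand k H X T \<alpha> * Q \<tau> a) = of_real (D (\<tau>, a))"
proof -
  let ?T = "\<lambda>m. T + m * \<tau>" and ?\<alpha> = "\<lambda>m. \<alpha> + m *\<^sub>R a"
  let ?Z = "\<lambda>m. integ (partition_integrand k H X (?T m) (?\<alpha> m))"
  define Z' where "Z' = integ (partition_integrand k H X T \<alpha> * Q \<tau> a)"
  have dT: "(?T has_real_derivative \<tau>) (at 0)" by (auto intro!: derivative_eq_intros)
  have d\<alpha>: "(?\<alpha> has_vector_derivative a) (at 0)"
    by (auto intro!: derivative_eq_intros)
  have U0: "(?T 0, ?\<alpha> 0) \<in> U" using U(3) by simp
  note chain = partition_function_chain_rule[OF \<open>k \<noteq> 0\<close> sys U(1,2) U0 dT d\<alpha>]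
  show "integrable_q (partition_integrand k H X T \<alpha> * Q \<tau> a)"
    using chain(1) by (simp add: Q_def)
  have dZ: "(?Z has_vector_derivative Z') (at 0)"
    using chain(2) by (simp add: Q_def Z'_def)
  have "((\<lambda>m. Im (?Z m)) has_real_derivative Im Z') (at 0)"
    using bounded_linear.has_vector_derivative[OF bounded_linear_Im dZ]
    by (simp add: has_real_derivative_iff_has_vector_derivative)
  \<comment> \<open>\<open>eos\<close> sees only the real part of the partition function, so the
    imaginary part of \<open>Z'\<close> is treated separately: near \<open>0\<close> the line stays
    in \<open>U\<close>, where the partition function is real.\<close>
  moreover have "((\<lambda>m. Im (?Z m)) has_real_derivative 0) (at 0)"
  proof (rule has_field_derivative_transform_within_open)
    show "((\<lambda>_. 0) has_real_derivative 0) (at 0)" by simp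
    show "open ((\<lambda>m. (?T m, ?\<alpha> m)) -` U)"
      using U(1) by (intro open_vimage continuous_intros)
    show "0 \<in> (\<lambda>m. (?T m, ?\<alpha> m)) -` U" using U0 by simp
    show "0 = Im (?Z m)" if "m \<in> (\<lambda>m. (?T m, ?\<alpha> m)) -` U" for m
      using that U(2) Im_partition_function[OF sys] by (metis subsetD vimageD)
  qed
  ultimately have Im: "Im Z' = 0" by (rule DERIV_unique)
  have dRe: "((\<lambda>m. Re (?Z m)) has_real_derivative Re Z') (at 0)"
    using bounded_linear.has_vector_derivative[OF bounded_linear_Re dZ]
    by (simp add: has_real_derivative_iff_has_vector_derivative)
  \<comment> \<open>Since the partition function is \<open>1\<close> at \<open>m = 0\<close>, the
    term from differentiating the prefactor contains \<open>ln 1 = 0\<close>, and the logarithmic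
    derivative is just \<open>Re Z'\<close>.\<close>
  have "((\<lambda>m. \<kappa> * ?T m * ln (Re (?Z m))) has_real_derivative \<kappa> * T * Re Z') (at 0)"
    by (rule derivative_eq_intros dRe dT refl | simp add: state)+
  then have "((\<lambda>m. eos k \<kappa> H X (?T m, ?\<alpha> m)) has_real_derivative \<kappa> * T * Re Z') (at 0)"
    by (simp add: eos_def)
  moreover have "((\<lambda>m. eos k \<kappa> H X (?T m, ?\<alpha> m)) has_real_derivative D (\<tau>, a)) (at 0)"
  proof -
    have "((\<lambda>m. (?T m, ?\<alpha> m)) has_vector_derivative (\<tau>, a)) (at 0)"
      using dT d\<alpha> unfolding has_real_derivative_iff_has_vector_derivative
      by (rule has_vector_derivative_Pair)
    from vector_derivative_diff_chain_within[OF this, of "eos k \<kappa> H X" D]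
    show ?thesis
      using has_derivative_at_withinI[OF D]
      by (simp add: o_def has_real_derivative_iff_has_vector_derivative)
  qed
  ultimately have "\<kappa> * T * Re Z' = D (\<tau>, a)" by (rule DERIV_unique)
  then show "of_real (\<kappa> * T) * integ (partition_integrand k H X T \<alpha> * Q \<tau> a) = of_real (D (\<tau>, a))"
    using Im by (simp add: complex_eq_iff flip: Z'_def)
qed

section \<open>Thermal means as first derivatives of the equation of state\<close>

lemma entropy_scale:
  fixes H :: "'a::euclidean_star_algebra"
  assumes "T \<noteq> 0"
  shows "cnst (of_real T) * entropy H X T \<alpha> = H - qdot \<alpha> X"
  using assms by (simp add: entropy_def cnst_mult_assoc cnst_one)

text \<open>As \<open>S = (H - \<alpha> \<cdot> X) / T\<close>, multiplying the derivative of the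
  exponent by \<open>k * T\<close> gives \<open>\<tau> S + a \<cdot> X\<close>. The directions
  \<open>(1, 0)\<close> and \<open>(0, axis j 1)\<close> then single out \<open>S\<close> and
  \<open>X j\<close>.\<close>

lemma thermal_mean_derivative:
  fixes H :: "'a::euclidean_star_algebra" and X :: "'j::finite \<Rightarrow> 'a"
    and \<tau> :: real and a :: "real ^ 'j"
  assumes "k \<noteq> 0" "\<kappa> \<noteq> 0" and sys: "thermal_system H X"
    and U: "open U" "U \<subseteq> eos_domain k H X" "(T, \<alpha>) \<in> U"
    and state: "integ (partition_integrand k H X T \<alpha>) = 1"
    and D: "(eos k \<kappa> H X has_derivative D) (at (T, \<alpha>))"
  defines "A \<equiv> cnst (of_real \<tau>) * entropy H X T \<alpha> + qdot a X"
  shows "integrable_q (partition_integrand k H X T \<alpha> * A)"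
    and "thermal_mean k H X T \<alpha> A = of_real (k / \<kappa> * D (\<tau>, a))"
proof -
  have T: "T \<noteq> 0" using U(2,3) by (auto simp: eos_domain_def)
  let ?\<rho> = "partition_integrand k H X T \<alpha>"
  let ?Q = "cnst (of_real (\<tau> / (k * T\<^sup>2))) * (H - qdot \<alpha> X) +
      cnst (of_real (1 / (k * T))) * qdot a X"
  have "A = cnst (of_real (k * T)) * ?Q"
    using \<open>k \<noteq> 0\<close> T
    by (simp add: A_def entropy_def distrib_left cnst_mult_assoc cnst_one power2_eq_square)
  then have A: "?\<rho> * A = cnst (of_real (k * T)) * (?\<rho> * ?Q)"
    by (simp only: mult_cnst_left_commute)
  note der = eos_derivative[OF \<open>k \<noteq> 0\<close> sys U state D, of \<tau> a]
  show "integrable_q (?\<rho> * A)" unfolding A by (intro integrable_q_scale der(1))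
  \<comment> \<open>The factor \<open>\<kappa> * T\<close> is put in to match \<open>der(2)\<close>;
    it is nonzero and cancels at the end, leaving \<open>k / \<kappa>\<close>.\<close>
  have "of_real (\<kappa> * T) * thermal_mean k H X T \<alpha> A = of_real (k * T) * (of_real (\<kappa> * T) * integ (?\<rho> * ?Q))"
    unfolding thermal_mean_eq A integ_scale[OF der(1)] by simp
  also have "\<dots> = of_real (k * T) * of_real (D (\<tau>, a))" by (simp only: der(2))
  finally show "thermal_mean k H X T \<alpha> A = of_real (k / \<kappa> * D (\<tau>, a))"
    using \<open>\<kappa> \<noteq> 0\<close> T by (simp add: field_simps)
qed

text \<open>The last equation is the Euler equation, which holds because \<open>H = T S + \<alpha> \<cdot> X\<close> as quantities.\<close>

lemma thermal_means:
  fixes H :: "'a::euclidean_star_algebra" and X :: "'j::finite \<Rightarrow> 'a"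
  assumes "k \<noteq> 0" "\<kappa> \<noteq> 0" and sys: "thermal_system H X"
    and U: "open U" "U \<subseteq> eos_domain k H X" "(T, \<alpha>) \<in> U"
    and state: "integ (partition_integrand k H X T \<alpha>) = 1"
    and D: "(eos k \<kappa> H X has_derivative D) (at (T, \<alpha>))"
  shows "mean_S k H X T \<alpha> = of_real (k / \<kappa> * D (1, 0))"
    and "mean_X k H X T \<alpha> = (\<chi> j. of_real (k / \<kappa> * D (0, axis j 1)))"
    and "mean_H k H X T \<alpha> = of_real T * mean_S k H X T \<alpha> +
      (\<Sum>j\<in>UNIV. of_real (\<alpha> $ j) * mean_X k H X T \<alpha> $ j)"
proof -
  have T: "T \<noteq> 0" using U(2,3) by (auto simp: eos_domain_def)
  let ?\<rho> = "partition_integrand k H X T \<alpha>" and ?S = "entropy H X T \<alpha>"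
  note der = thermal_mean_derivative[OF assms]
  \<comment> \<open>Integrability of these products comes out of the chain rule; it is what permits
    splitting the integral of the Euler equation into a sum.\<close>
  have int_S: "integrable_q (?\<rho> * ?S)"
    using der(1)[of 1 0] by (simp add: cnst_one qdot_zero)
  have int_X: "integrable_q (?\<rho> * X j)" for j
    using der(1)[of 0 "axis j 1"] by (simp add: cnst_zero qdot_axis)
  show "mean_S k H X T \<alpha> = of_real (k / \<kappa> * D (1, 0))"
    using der(2)[of 1 0] by (simp add: mean_S_def cnst_one qdot_zero)
  show "mean_X k H X T \<alpha> = (\<chi> j. of_real (k / \<kappa> * D (0, axis j 1)))"
    using der(2)[of 0 "axis j 1" for j] by (simp add: mean_X_def vec_eq_iff cnst_zero qdot_axis)
  have "H = cnst (of_real T) * ?S + qdot \<alpha> X" by (simp add: entropy_scale[OF T])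
  then have "?\<rho> * H = ?\<rho> * (cnst (of_real T) * ?S + qdot \<alpha> X)" by (rule arg_cong)
  also have "\<dots> = cnst (of_real T) * (?\<rho> * ?S) + (\<Sum>j\<in>UNIV. cnst (of_real (\<alpha> $ j)) * (?\<rho> * X j))"
    by (simp add: distrib_left qdot_def sum_distrib_left mult_cnst_left_commute)
  finally show "mean_H k H X T \<alpha> = of_real T * mean_S k H X T \<alpha> +
      (\<Sum>j\<in>UNIV. of_real (\<alpha> $ j) * mean_X k H X T \<alpha> $ j)"
    using int_S int_X
    by (simp add: mean_H_def mean_S_def mean_X_def thermal_mean_eq integ_add integ_scale
        integrable_q_scale integrable_q_sum)
qed

section \<open>The Gibbs-Duhem equation and the first law along a transformation\<close>

lemma partition_function_state_space:
  fixes H :: "'a::euclidean_star_algebra"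
  assumes "thermal_system H X" "\<kappa> > 0" "(T, \<alpha>) \<in> state_space k \<kappa> H X"
  shows "integ (partition_integrand k H X T \<alpha>) = 1"
  using gibbs_entropy_entropy[OF assms] unfolding gibbs_entropy_def
  by (simp add: entropy_def partition_integrand_def cnst_mult_assoc flip: of_real_mult)

text \<open>Used to write \<open>d\<Delta> = 0\<close> in terms of partial derivatives, which are
  multiples of the means of \<open>S\<close> and \<open>X j\<close>.\<close>

lemma bounded_linear_pair_sum:
  fixes D :: "real \<times> (real ^ 'j::finite) \<Rightarrow> real"
  assumes "bounded_linear D"
  shows "D (\<tau>, a) = \<tau> * D (1, 0) + (\<Sum>j\<in>UNIV. a $ j * D (0, axis j 1))"
proof -
  interpret bounded_linear D by fact
  have "(0, a) = (\<Sum>j\<in>UNIV. a $ j *\<^sub>R (0 :: real, axis j (1::real)))"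
    by (rule prod_eqI) (auto simp: fst_sum snd_sum vec_eq_iff axis_def if_distrib cong: if_cong)
  then have "D (0, a) = (\<Sum>j\<in>UNIV. a $ j * D (0, axis j 1))"
    by (simp only: sum scaleR) simp
  moreover have "D (\<tau>, a) = \<tau> * D (1, 0) + D (0, a)"
    using add[of "\<tau> *\<^sub>R (1, 0)" "(0, a)"] scaleR[of \<tau> "(1, 0)"] by simp
  ultimately show ?thesis by simp
qed


theorem theorem10p2:
  fixes k \<kappa> :: real
    and H :: "'a::euclidean_star_algebra"
    and X :: "'j::finite \<Rightarrow> 'a"
    and U :: "(real \<times> (real ^ 'j)) set"
    and L :: "real set"
    and T :: "real \<Rightarrow> real"
    and \<alpha> :: "real \<Rightarrow> real ^ 'j"
  assumes "k > 0" and "\<kappa> > 0"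
    and "thermal_system H X"
    and "regular_region k \<kappa> H X U"
    and "reversible_transformation k \<kappa> H X L T \<alpha>"
    and "\<And>l. l \<in> L \<Longrightarrow> (T l, \<alpha> l) \<in> U"
  shows "\<forall>l\<in>L. \<exists>dT d\<alpha> dH dS dX.
      (T has_real_derivative dT) (at l within L) \<and>
      (\<alpha> has_vector_derivative d\<alpha>) (at l within L) \<and>
      ((\<lambda>m. mean_H k H X (T m) (\<alpha> m)) has_vector_derivative dH) (at l within L) \<and>
      ((\<lambda>m. mean_S k H X (T m) (\<alpha> m)) has_vector_derivative dS) (at l within L) \<and>
      ((\<lambda>m. mean_X k H X (T m) (\<alpha> m)) has_vector_derivative dX) (at l within L) \<and>
      dH = of_real (T l) * dS + (\<Sum>j\<in>UNIV. of_real (\<alpha> l $ j) * dX $ j) \<and>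
      0 = mean_S k H X (T l) (\<alpha> l) * of_real dT +
          (\<Sum>j\<in>UNIV. mean_X k H X (T l) (\<alpha> l) $ j * of_real (d\<alpha> $ j))"
proof
  fix l assume l: "l \<in> L"
  have k: "k \<noteq> 0" and \<kappa>: "\<kappa> \<noteq> 0" using assms(1,2) by auto
  let ?\<Delta> = "eos k \<kappa> H X" and ?p = "\<lambda>m. (T m, \<alpha> m)"
  have U: "open U" "U \<subseteq> eos_domain k H X"
    using assms(4) by (auto simp: regular_region_def)
  obtain D :: "real \<times> (real ^ 'j) \<Rightarrow> (real \<times> (real ^ 'j)) \<Rightarrow>\<^sub>L real"
    and D2 :: "real \<times> (real ^ 'j) \<Rightarrow>
      (real \<times> (real ^ 'j)) \<Rightarrow>\<^sub>L (real \<times> (real ^ 'j)) \<Rightarrow>\<^sub>L real"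
    where D: "\<And>x. x \<in> U \<Longrightarrow> (?\<Delta> has_derivative D x) (at x)"
      and D2: "\<And>x. x \<in> U \<Longrightarrow> (D has_derivative D2 x) (at x)"
    using assms(4) unfolding regular_region_def twice_continuously_differentiable_on_def by blast
  obtain dT d\<alpha> where dT: "(T has_real_derivative dT) (at l within L)"
    and d\<alpha>: "(\<alpha> has_vector_derivative d\<alpha>) (at l within L)"
    using assms(5) l unfolding reversible_transformation_def by blast
  have state: "?p m \<in> state_space k \<kappa> H X" if "m \<in> L" for m
    using assms(5) that by (simp add: reversible_transformation_def)
  \<comment> \<open>A nondegenerate interval has no isolated points, so derivatives within
    \<open>L\<close> are unique, even at an end point.\<close>
  have non_trivial: "at l within L \<noteq> bot"
  proof -
    obtain a b where "a \<in> L" "b \<in> L" "a < b" and "is_interval L"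
      using assms(5) unfolding reversible_transformation_def by blast
    then have "connected L" "L \<noteq> {x}" for x by (auto simp: is_interval_connected)
    then have "l islimpt L" using l by (intro connected_imp_perfect)
    then show ?thesis by (simp add: trivial_limit_within)
  qed
  have means:
    "mean_S k H X (T m) (\<alpha> m) = of_real (k / \<kappa> * D (?p m) (1, 0))"
    "mean_X k H X (T m) (\<alpha> m) = (\<chi> j. of_real (k / \<kappa> * D (?p m) (0, axis j 1)))"
    "mean_H k H X (T m) (\<alpha> m) = of_real (T m) * mean_S k H X (T m) (\<alpha> m) +
      (\<Sum>j\<in>UNIV. of_real (\<alpha> m $ j) * mean_X k H X (T m) (\<alpha> m) $ j)"
    if "m \<in> L" for m
    using thermal_means[OF k \<kappa> assms(3) U assms(6)[OF that]
        partition_function_state_space[OF assms(3,2) state[OF that]] D[OF assms(6)[OF that]]]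
    by blast+
  have dp: "(?p has_vector_derivative (dT, d\<alpha>)) (at l within L)"
    using dT d\<alpha> unfolding has_real_derivative_iff_has_vector_derivative
    by (rule has_vector_derivative_Pair)

  \<comment> \<open>\<Delta> vanishes on the state space, so its derivative along the curve is
    \<open>0\<close> as well as the value given by the chain rule.\<close>
  have "((\<lambda>m. ?\<Delta> (?p m)) has_vector_derivative D (?p l) (dT, d\<alpha>)) (at l within L)"
    using vector_derivative_diff_chain_within[OF dp has_derivative_at_withinI[OF D[OF assms(6)[OF l]]]]
    by (simp add: o_def)
  moreover have "((\<lambda>m. ?\<Delta> (?p m)) has_vector_derivative 0) (at l within L)"
    using l _ has_vector_derivative_const[of "0 :: real" "at l within L"]
    by (rule has_vector_derivative_transform) (use state in \<open>auto simp: state_space_def\<close>)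
  ultimately have "D (?p l) (dT, d\<alpha>) = 0"
    using non_trivial by (rule vector_derivative_unique_within[rotated])
  then have "dT * D (?p l) (1, 0) + (\<Sum>j\<in>UNIV. d\<alpha> $ j * D (?p l) (0, axis j 1)) = 0"
    using bounded_linear_pair_sum[OF blinfun.bounded_linear_right, of "D (?p l)" dT d\<alpha>]
    by simp
  \<comment> \<open>The factor \<open>k / \<kappa>\<close> turns the partial derivatives into the
    means.\<close>
  then have "of_real (k / \<kappa> * (dT * D (?p l) (1, 0) +
      (\<Sum>j\<in>UNIV. d\<alpha> $ j * D (?p l) (0, axis j 1)))) = (0 :: complex)"
    by simp
  then have gibbs_duhem: "mean_S k H X (T l) (\<alpha> l) * of_real dT +
      (\<Sum>j\<in>UNIV. mean_X k H X (T l) (\<alpha> l) $ j * of_real (d\<alpha> $ j)) = 0"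
    unfolding means(1,2)[OF l]
    by (simp add: distrib_left sum_distrib_left mult_ac)

  \<comment> \<open>The means are values of the first derivative of \<Delta> in fixed directions.
    Evaluation in a direction \<open>v\<close> is bounded linear, so the second derivative
    differentiates them along the curve.\<close>
  have dD: "((\<lambda>m. complex_of_real (k / \<kappa> * D (?p m) v)) has_vector_derivative
      of_real (k / \<kappa> * D2 (?p l) (dT, d\<alpha>) v)) (at l within L)" for v
  proof -
    have "((\<lambda>m. D (?p m)) has_vector_derivative D2 (?p l) (dT, d\<alpha>)) (at l within L)"
      using vector_derivative_diff_chain_within[OF dp has_derivative_at_withinI[OF D2[OF assms(6)[OF l]]]]
      by (simp add: o_def)
    moreover have "bounded_linear (\<lambda>B. of_real (k / \<kappa> * blinfun_apply B v) :: complex)"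
      by (intro bounded_linear_compose[OF bounded_linear_of_real]
          bounded_linear_const_mult blinfun.bounded_linear_left)
    ultimately show ?thesis by (rule bounded_linear.has_vector_derivative[rotated])
  qed
  define dS :: complex where "dS = of_real (k / \<kappa> * D2 (?p l) (dT, d\<alpha>) (1, 0))"
  define dX :: "complex ^ 'j"
    where "dX = (\<chi> j. of_real (k / \<kappa> * D2 (?p l) (dT, d\<alpha>) (0, axis j 1)))"
  \<comment> \<open>The formulas for the means are known only at points of \<open>L\<close>, hence
    the transfer of derivatives within \<open>L\<close>, here and below.\<close>
  have dS: "((\<lambda>m. mean_S k H X (T m) (\<alpha> m)) has_vector_derivative dS) (at l within L)"
    using l means(1) dD[of "(1, 0)"] unfolding dS_def by (rule has_vector_derivative_transform)
  have dXj: "((\<lambda>m. mean_X k H X (T m) (\<alpha> m) $ j) has_vector_derivative dX $ j) (at l within L)" for j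
    using l _ dD[of "(0, axis j 1)"] unfolding dX_def vec_lambda_beta
    by (rule has_vector_derivative_transform) (simp add: means(2))
  have dX: "((\<lambda>m. mean_X k H X (T m) (\<alpha> m)) has_vector_derivative dX) (at l within L)"
    using dXj by (rule has_vector_derivative_vecI)
  have d\<alpha>j: "((\<lambda>m. of_real (\<alpha> m $ j) :: complex) has_vector_derivative of_real (d\<alpha> $ j)) (at l within L)" for j
    using bounded_linear.has_vector_derivative[OF bounded_linear_compose[OF bounded_linear_of_real bounded_linear_vec_nth] d\<alpha>] .
  have dTc: "((\<lambda>m. of_real (T m) :: complex) has_vector_derivative of_real dT) (at l within L)"
    using dT by (auto simp: has_real_derivative_iff_has_vector_derivative
      intro: bounded_linear.has_vector_derivative[OF bounded_linear_of_real])
  let ?E = "\<lambda>m. of_real (T m) * mean_S k H X (T m) (\<alpha> m) +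
      (\<Sum>j\<in>UNIV. of_real (\<alpha> m $ j) * mean_X k H X (T m) (\<alpha> m) $ j)"
  \<comment> \<open>With \<open>dH\<close> defined by the first law, it remains to see that it is
    the derivative of the mean of \<open>H\<close>. The product rule on the Euler equation adds the
    terms with \<open>dT\<close> and \<open>d\<alpha>\<close>, whose sum is \<open>0\<close> by
    Gibbs-Duhem.\<close>
  define dH where "dH = of_real (T l) * dS + (\<Sum>j\<in>UNIV. of_real (\<alpha> l $ j) * dX $ j)"
  have "(?E has_vector_derivative
      (of_real (T l) * dS + of_real dT * mean_S k H X (T l) (\<alpha> l)) +
      (\<Sum>j\<in>UNIV. of_real (\<alpha> l $ j) * dX $ j +
        of_real (d\<alpha> $ j) * mean_X k H X (T l) (\<alpha> l) $ j)) (at l within L)"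
    by (intro has_vector_derivative_add has_vector_derivative_sum has_vector_derivative_mult
        dTc dS d\<alpha>j dXj)
  also have "(of_real (T l) * dS + of_real dT * mean_S k H X (T l) (\<alpha> l)) +
      (\<Sum>j\<in>UNIV. of_real (\<alpha> l $ j) * dX $ j +
        of_real (d\<alpha> $ j) * mean_X k H X (T l) (\<alpha> l) $ j) = dH"
    using gibbs_duhem by (simp add: dH_def sum.distrib algebra_simps)
  finally have "(?E has_vector_derivative dH) (at l within L)" .
  with l means(3) have dH: "((\<lambda>m. mean_H k H X (T m) (\<alpha> m)) has_vector_derivative dH) (at l within L)"
    by (rule has_vector_derivative_transform)
  show "\<exists>dT d\<alpha> dH dS dX.
      (T has_real_derivative dT) (at l within L) \<and>
      (\<alpha> has_vector_derivative d\<alpha>) (at l within L) \<and>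
      ((\<lambda>m. mean_H k H X (T m) (\<alpha> m)) has_vector_derivative dH) (at l within L) \<and>
      ((\<lambda>m. mean_S k H X (T m) (\<alpha> m)) has_vector_derivative dS) (at l within L) \<and>
      ((\<lambda>m. mean_X k H X (T m) (\<alpha> m)) has_vector_derivative dX) (at l within L) \<and>
      dH = of_real (T l) * dS + (\<Sum>j\<in>UNIV. of_real (\<alpha> l $ j) * dX $ j) \<and>
      0 = mean_S k H X (T l) (\<alpha> l) * of_real dT +
          (\<Sum>j\<in>UNIV. mean_X k H X (T l) (\<alpha> l) $ j * of_real (d\<alpha> $ j))"
    using dT d\<alpha> dH dS dX dH_def gibbs_duhem[symmetric] by blast
qed

end
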